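(* Let $H(\mathbb{C})$ be the space of entire functions on $\mathbb{C}$ with the compact-open topology, and let $M:H(\mathbb{C})\times H(\mathbb{C})\to H(\mathbb{C})$ be the bilinear operator $M(f,g)=f(0)\,g'$. Then $M$ is hypercyclic and not strongly transitive.
   Context: Let $X$ be a Fréchet space and $M:X\times X\to X$ a continuous bilinear operator. For initial conditions $(x_{-1},x_0)\in X^2$ define inductively $x_n:=M(x_{n-2},x_{n-1})$ for $n\geq 1$, and write $M^n(x_{-1},x_0):=x_n$ for $n\ge 1$, so that $M^n:X\times X\to X$. The operator $M$ is called hypercyclic if there is $(x_{-1},x_0)\in X^2$ such that the orbit $\{x_n:n\geq -1\}$ is dense in $X$; such a pair is called a hypercyclic vector. The operator $M$ is called strongly transitive if the family $\{M^n:n\in\mathbb{N}\}$ is transitive, i.e. for all nonempty open sets $U\subseteq X\times X$ and $V\subseteq X$ there is $n\in\mathbb{N}$ with $M^n(U)\cap V\neq\emptyset$ (for separable $X$, equivalently, $M$ is hypercyclic and its set of hypercyclic vectors is residual in $X\times X$). *)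

theory Defs
  imports "HOL-Complex_Analysis.Complex_Analysis"
begin

section \<open>The space of entire functions\<close>

typedef entire = "{f :: complex \<Rightarrow> complex. f holomorphic_on UNIV}"
  morphisms apply_entire Abs_entire
  by (rule exI[of _ "\<lambda>_. 0"]) simp

setup_lifting type_definition_entire

text \<open>The compact-open topology, generated by the sets of all functions that map a given
  compact set into a given open set.\<close>

instantiation entire :: topological_space
begin

definition open_entire :: "entire set \<Rightarrow> bool" where
  "open_entire = generate_topology
     {{f. apply_entire f ` K \<subseteq> W} | K W. compact K \<and> open W}"

instance
  by standard
    (auto simp: open_entire_def intro: generate_topology.UNIV generate_topology.Int
      generate_topology.UN)

end

section \<open>Dynamics of bilinear operators\<close>

text \<open>Indices are shifted by one, since the orbit of \<open>(x\<^sub>-\<^sub>1, x\<^sub>0)\<close> starts at index \<open>-1\<close>: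
  \<open>bilinear_orbit M p k\<close> is \<open>x\<^sub>k\<^sub>-\<^sub>1\<close>.\<close>

fun bilinear_orbit :: "('a \<times> 'a \<Rightarrow> 'a) \<Rightarrow> 'a \<times> 'a \<Rightarrow> nat \<Rightarrow> 'a" where
  "bilinear_orbit M p 0 = fst p"
| "bilinear_orbit M p (Suc 0) = snd p"
| "bilinear_orbit M p (Suc (Suc n)) = M (bilinear_orbit M p n, bilinear_orbit M p (Suc n))"

text \<open>The map \<open>M\<^sup>n\<close>, sending \<open>(x\<^sub>-\<^sub>1, x\<^sub>0)\<close> to \<open>x\<^sub>n\<close>; it is meant for \<open>n \<ge> 1\<close>.\<close>

definition bilinear_iterate :: "('a \<times> 'a \<Rightarrow> 'a) \<Rightarrow> nat \<Rightarrow> 'a \<times> 'a \<Rightarrow> 'a" where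
  "bilinear_iterate M n p = bilinear_orbit M p (Suc n)"

definition hypercyclic_vector ::
    "('a::topological_space \<times> 'a \<Rightarrow> 'a) \<Rightarrow> 'a \<times> 'a \<Rightarrow> bool" where
  "hypercyclic_vector M p \<longleftrightarrow> closure (range (bilinear_orbit M p)) = UNIV"

definition hypercyclic :: "('a::topological_space \<times> 'a \<Rightarrow> 'a) \<Rightarrow> bool" where
  "hypercyclic M \<longleftrightarrow> (\<exists>p. hypercyclic_vector M p)"

definition strongly_transitive :: "('a::topological_space \<times> 'a \<Rightarrow> 'a) \<Rightarrow> bool" where
  "strongly_transitive M \<longleftrightarrow>
     (\<forall>U V. open U \<and> U \<noteq> {} \<and> open V \<and> V \<noteq> {} \<longrightarrow>
       (\<exists>n\<ge>1. bilinear_iterate M n ` U \<inter> V \<noteq> {}))"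

lift_definition eval_deriv_op :: "entire \<times> entire \<Rightarrow> entire" is
  "\<lambda>(f, g) z. f 0 * deriv g z"
  by (auto intro!: holomorphic_intros holomorphic_deriv)

end

theory Submission
  imports Defs
begin

text \<open>
  The orbit of \<open>(f, g)\<close> is \<open>x\<^sub>n = c\<^sub>n g\<^sup>(\<^sup>n\<^sup>)\<close> with
  \<open>c\<^sub>0 = 1\<close>, \<open>c\<^sub>1 = f(0)\<close> and \<open>c\<^sub>n\<^sub>+\<^sub>2 = c\<^sub>n\<^sub>+\<^sub>1 c\<^sub>n a\<^sub>n\<close>, where
  \<open>a\<^sub>n = g\<^sup>(\<^sup>n\<^sup>)(0)\<close>.

  If \<open>\<bar>f(0)\<bar>\<close> is small and \<open>\<bar>g\<bar> < 1\<close> on the unit disc, then \<open>\<bar>a\<^sub>n\<bar> \<le> n!\<close> by Cauchy's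
  estimates, and the recursion makes \<open>c\<^sub>n\<close> so small that \<open>\<bar>x\<^sub>n(0)\<bar> \<le> 1\<close> for all \<open>n \<ge> 1\<close>.

  For hypercyclicity the nonzero sequence \<open>c\<close> may be chosen freely, as it determines
  \<open>a\<^sub>j = c\<^sub>j\<^sub>+\<^sub>2 / (c\<^sub>j\<^sub>+\<^sub>1 c\<^sub>j)\<close>. To make \<open>c\<^sub>n a\<^sub>n\<^sub>+\<^sub>k = p\<^sub>k\<close> for all \<open>k \<le> d\<close>, take
  \<open>c\<^sub>n\<^sub>+\<^sub>k = C q\<^sub>k\<close> with \<open>q\<^sub>0 = 1\<close>, \<open>q\<^sub>1 = s\<close> and \<open>q\<^sub>k\<^sub>+\<^sub>2 = q\<^sub>k\<^sub>+\<^sub>1 q\<^sub>k p\<^sub>k\<close>. A large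
  \<open>C\<close> makes the new \<open>a\<^sub>j\<close> small, and a large \<open>s\<close> makes \<open>c\<close> so large at the end of the block
  that from there on tiny \<open>a\<^sub>j\<close> suffice to keep \<open>c\<close> growing until the next block starts.
\<close>

section \<open>Exponential generating functions and the compact-open topology\<close>

text \<open>With this normalisation and bounded \<open>a\<close>, the function is entire,
  \<open>a k\<close> is its k-th derivative at 0, and differentiation merely shifts
  \<open>a\<close>.\<close>

definition egf :: "(nat \<Rightarrow> complex) \<Rightarrow> complex \<Rightarrow> complex" where
  "egf a z = (\<Sum>k. a k / fact k * z ^ k)"

lemma norm_egf_term_le:
  fixes a :: "nat \<Rightarrow> complex"
  assumes "norm (a k) \<le> B"
  shows "norm (a k / fact k * z ^ k) \<le> B * (norm z ^ k /\<^sub>R fact k)"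
proof -
  have "norm (a k) * (norm z ^ k / fact k) \<le> B * (norm z ^ k / fact k)"
    using assms by (rule mult_right_mono) simp
  thus ?thesis by (simp add: norm_mult norm_divide norm_power divide_inverse norm_inverse mult_ac)
qed

lemma summable_egf:
  fixes a :: "nat \<Rightarrow> complex"
  assumes "\<And>k. norm (a k) \<le> B"
  shows "summable (\<lambda>k. norm (a k / fact k * z ^ k))"
proof (rule summable_comparison_test')
  show "summable (\<lambda>k. B * (norm z ^ k /\<^sub>R fact k))"
    by (intro summable_mult summable_exp_generic)
qed (use norm_egf_term_le[OF assms] in simp)

lemma norm_egf_le:
  assumes "\<And>k. norm (a k) \<le> B"
  shows "norm (egf a z) \<le> B * exp (norm z)"
proof -
  have exp: "(\<lambda>k. B * (norm z ^ k /\<^sub>R fact k)) sums (B * exp (norm z))"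
    by (intro sums_mult exp_converges)
  have "norm (egf a z) \<le> (\<Sum>k. norm (a k / fact k * z ^ k))"
    unfolding egf_def by (rule summable_norm[OF summable_egf[OF assms]])
  also have "\<dots> \<le> (\<Sum>k. B * (norm z ^ k /\<^sub>R fact k))"
    using norm_egf_term_le[OF assms] summable_egf[OF assms] sums_summable[OF exp]
    by (rule suminf_le)
  also have "\<dots> = B * exp (norm z)"
    using exp by (simp add: sums_iff)
  finally show ?thesis .
qed

lemma egf_has_field_derivative:
  assumes "\<And>k. norm (a k) \<le> B"
  shows "(egf a has_field_derivative egf (\<lambda>k. a (Suc k)) z) (at z)"
proof -
  have "((\<lambda>z. \<Sum>k. a k / fact k * z ^ k) has_field_derivative
          (\<Sum>k. diffs (\<lambda>k. a k / fact k) k * z ^ k)) (at z)"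
    using summable_egf[OF assms]
    by (intro termdiffs_strong_converges_everywhere) (auto intro: summable_norm_cancel)
  moreover have "diffs (\<lambda>k. a k / fact k) = (\<lambda>k. a (Suc k) / fact k)"
    by (simp add: diffs_def fun_eq_iff field_simps del: of_nat_Suc)
  ultimately show ?thesis
    by (simp add: egf_def[abs_def])
qed

lemma higher_deriv_egf:
  assumes "\<And>k. norm (a k) \<le> B"
  shows "(deriv ^^ n) (egf a) = egf (\<lambda>k. a (n + k))"
proof (induction n)
  case (Suc n)
  show ?case
    using egf_has_field_derivative[of "\<lambda>k. a (n + k)" B] assms
    by (simp add: Suc fun_eq_iff DERIV_imp_deriv)
qed auto

lemma egf_0 [simp]: "egf a 0 = a 0"
  unfolding egf_def using powser_zero[of "\<lambda>k. a k / fact k"] by simp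

lemma egf_holomorphic:
  assumes "\<And>k. norm (a k) \<le> B"
  shows "egf a holomorphic_on UNIV"
  using egf_has_field_derivative[of a, OF assms] by (auto simp: holomorphic_on_open)

section \<open>Taylor expansion and disc neighbourhoods\<close>

lemma taylor_series_sums:
  assumes "h holomorphic_on UNIV"
  shows "((\<lambda>k. (deriv ^^ k) h 0 / fact k * z ^ k) sums h z)"
  using holomorphic_power_series[of h 0 "norm z + 1" z] assms
  by (auto intro: holomorphic_on_subset)

lemma taylor_uniform:
  assumes "h holomorphic_on UNIV" "e > 0"
  obtains d where "\<And>z. norm z \<le> R \<Longrightarrow>
    norm (h z - (\<Sum>k\<le>d. (deriv ^^ k) h 0 / fact k * z ^ k)) < e"
proof -
  let ?a = "\<lambda>k. (deriv ^^ k) h 0 / fact k"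
  \<comment> \<open>Convergence at a strictly larger radius yields absolute convergence at radius
    \<open>\<bar>R\<bar>\<close>, as the Weierstrass M-test requires.\<close>
  have "summable (\<lambda>k. ?a k * of_real (\<bar>R\<bar> + 1) ^ k)"
    using taylor_series_sums[OF assms(1)] by (rule sums_summable)
  from powser_insidea[OF this, of "of_real \<bar>R\<bar>"]
  have *: "summable (\<lambda>k. norm (?a k) * \<bar>R\<bar> ^ k)"
    by (simp only: norm_mult norm_power norm_of_real) simp
  have "uniform_limit (cball 0 \<bar>R\<bar>) (\<lambda>n z. \<Sum>k<n. ?a k * z ^ k) (\<lambda>z. \<Sum>k. ?a k * z ^ k) sequentially"
    by (rule Weierstrass_m_test[OF _ *])
       (auto simp only: norm_mult norm_power mem_cball_0 intro!: mult_left_mono power_mono norm_ge_zero)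
  hence "\<forall>\<^sub>F n in sequentially. \<forall>z\<in>cball 0 \<bar>R\<bar>. dist (\<Sum>k<n. ?a k * z ^ k) (\<Sum>k. ?a k * z ^ k) < e"
    using assms(2) by (auto simp: uniform_limit_iff)
  hence "\<forall>\<^sub>F n in sequentially. \<forall>z\<in>cball 0 \<bar>R\<bar>. dist (\<Sum>k<Suc n. ?a k * z ^ k) (\<Sum>k. ?a k * z ^ k) < e"
    by (subst eventually_sequentially_Suc)
  then obtain d where "\<forall>z\<in>cball 0 \<bar>R\<bar>. dist (\<Sum>k<Suc d. ?a k * z ^ k) (\<Sum>k. ?a k * z ^ k) < e"
    by (auto simp: eventually_sequentially)
  thus ?thesis
    unfolding sums_unique[OF taylor_series_sums[OF assms(1)], symmetric]
    by (intro that[of d]) (simp add: lessThan_Suc_atMost dist_norm norm_minus_commute)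
qed

text \<open>Induction on the generation of the topology leaves the subbasic sets. There the compact
  image of \<open>K\<close> under \<open>h\<close> has a uniform margin inside \<open>W\<close>, and
  some disc contains \<open>K\<close>.\<close>

lemma open_entire_contains_nbhd:
  assumes "open S" "h \<in> S"
  shows "\<exists>R e. e > 0 \<and> (\<forall>f. (\<forall>z. norm z \<le> R \<longrightarrow>
      norm (apply_entire f z - apply_entire h z) < e) \<longrightarrow> f \<in> S)"
  using assms unfolding open_entire_def
proof (induction S rule: generate_topology.induct)
  case UNIV
  show ?case by (intro exI[of _ 1]) auto
next
  case (Int S T)
  then have "h \<in> S" "h \<in> T" by auto
  from Int.IH(1)[OF this(1)] obtain R e where e: "e > 0"
    "\<And>f. \<forall>z. norm z \<le> R \<longrightarrow> norm (apply_entire f z - apply_entire h z) < e \<Longrightarrow> f \<in> S"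
    by blast
  from Int.IH(2)[OF \<open>h \<in> T\<close>] obtain R' e' where e': "e' > 0"
    "\<And>f. \<forall>z. norm z \<le> R' \<longrightarrow> norm (apply_entire f z - apply_entire h z) < e' \<Longrightarrow> f \<in> T"
    by blast
  have "f \<in> S \<inter> T" if "\<forall>z. norm z \<le> max R R' \<longrightarrow>
      norm (apply_entire f z - apply_entire h z) < min e e'" for f
    using e(2)[of f] e'(2)[of f] that by simp
  with e(1) e'(1) show ?case
    by (intro exI[of _ "max R R'"] exI[of _ "min e e'"]) simp
next
  case (UN K)
  then obtain S where S: "S \<in> K" "h \<in> S" by blast
  from UN.IH[OF this] obtain R e where "e > 0"
    "\<And>f. \<forall>z. norm z \<le> R \<longrightarrow> norm (apply_entire f z - apply_entire h z) < e \<Longrightarrow> f \<in> S"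
    by blast
  with S show ?case by (intro exI[of _ R] exI[of _ e]) blast
next
  case (Basis S)
  then obtain K W where KW: "S = {f. apply_entire f ` K \<subseteq> W}" "compact K" "open W"
    by auto
  have "compact (apply_entire h ` K)"
    using apply_entire[of h] KW(2)
    by (auto intro!: compact_continuous_image holomorphic_on_imp_continuous_on
        intro: holomorphic_on_subset)
  moreover have "apply_entire h ` K \<subseteq> W"
    using Basis.prems KW(1) by auto
  ultimately obtain e where e: "e > 0" "(\<Union>x\<in>apply_entire h ` K. ball x e) \<subseteq> W"
    by (rule compact_subset_open_imp_ball_epsilon_subset[OF _ KW(3)])
  obtain R where R: "\<And>z. z \<in> K \<Longrightarrow> norm z \<le> R"
    using compact_imp_bounded[OF KW(2)] by (auto simp: bounded_iff)
  have "f \<in> S" if "\<forall>z. norm z \<le> R \<longrightarrow> norm (apply_entire f z - apply_entire h z) < e" for f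
  proof -
    have "apply_entire f z \<in> ball (apply_entire h z) e" if "z \<in> K" for z
      using R[OF that] \<open>\<forall>z. _\<close> by (simp add: dist_norm norm_minus_commute)
    with e(2) show ?thesis unfolding KW(1) by blast
  qed
  with e(1) show ?case by blast
qed

section \<open>Orbits, and failure of strong transitivity\<close>

fun orbit_coeff :: "complex \<Rightarrow> (nat \<Rightarrow> complex) \<Rightarrow> nat \<Rightarrow> complex" where
  "orbit_coeff b a 0 = 1"
| "orbit_coeff b a (Suc 0) = b"
| "orbit_coeff b a (Suc (Suc n)) = orbit_coeff b a (Suc n) * orbit_coeff b a n * a n"

lemma higher_deriv_holomorphic:
  "(deriv ^^ n) (apply_entire g) holomorphic_on UNIV"
  using apply_entire[of g] by (intro holomorphic_higher_deriv) auto

text \<open>Each step evaluates the older term at 0, which contributes a scalar, and differentiates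
  the newer one. The left index is \<open>Suc n\<close> because the orbit starts at index
  -1.\<close>

lemma bilinear_orbit_eval_deriv_op:
  "apply_entire (bilinear_orbit eval_deriv_op (f, g) (Suc n)) =
     (\<lambda>z. orbit_coeff (apply_entire f 0) (\<lambda>k. (deriv ^^ k) (apply_entire g) 0) n *
       (deriv ^^ n) (apply_entire g) z)"
proof (induction n rule: less_induct)
  case (less n)
  have deriv: "deriv (\<lambda>z. C * (deriv ^^ m) (apply_entire g) z) z =
      C * (deriv ^^ Suc m) (apply_entire g) z" for C m z
    using higher_deriv_holomorphic[of m g]
    by (subst deriv_cmult) (auto simp: holomorphic_on_def field_differentiable_at_within)
  consider "n = 0" | "n = 1" | m where "n = Suc (Suc m)"
    by (metis One_nat_def not0_implies_Suc)
  then show ?case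
  proof cases
    case 3
    then show ?thesis
      using less[of m] less[of "Suc m"]
      by (simp add: eval_deriv_op.rep_eq deriv fun_eq_iff del: funpow.simps)
  qed (auto simp: eval_deriv_op.rep_eq fun_eq_iff)
qed

lemma fact_growth: "real (Suc (Suc (Suc n))) ^ 2 \<le> 16 * fact (Suc n)"
proof (induction n)
  case (Suc n)
  have "real (Suc (Suc (Suc (Suc n)))) ^ 2 \<le> real (Suc (Suc n)) * real (Suc (Suc (Suc n))) ^ 2"
    by (simp add: power2_eq_square algebra_simps)
  also have "\<dots> \<le> real (Suc (Suc n)) * (16 * fact (Suc n))"
    using Suc by (intro mult_left_mono) auto
  finally show ?case by (simp add: algebra_simps)
qed (simp add: power2_eq_square)

text \<open>This decay beats the factorial growth of \<open>a\<close>. It starts at index 1, since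
  the scalar at index 0 is 1; hence index 2 is a separate base case.\<close>

lemma norm_orbit_coeff_le:
  assumes b: "norm b \<le> 1 / 64" and a: "\<And>k. norm (a k) \<le> fact k"
  shows "norm (orbit_coeff b a (Suc n)) \<le> 1 / (16 * fact (Suc n) ^ 2)"
proof (induction n rule: less_induct)
  case (less n)
  consider "n = 0" | "n = 1" | m where "n = Suc (Suc m)"
    by (metis One_nat_def not0_implies_Suc)
  then show ?case
  proof cases
    case 2
    \<comment> \<open>The constant \<open>1 / 64\<close> equals
      \<open>1 / (16 * fact 2 ^ 2)\<close>, exactly what index 2 demands.\<close>
    have "norm b * norm (a 0) \<le> (1 / 64) * 1"
      using b a[of 0] by (intro mult_mono) auto
    with 2 show ?thesis by (simp add: norm_mult power2_eq_square fact_numeral)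
  next
    case 3
    define F where "F = (fact (Suc m) :: real)"
    have F: "F > 0" by (simp add: F_def)
    have "norm (orbit_coeff b a (Suc (Suc m)) * orbit_coeff b a (Suc m) * a (Suc m)) \<le>
        1 / (16 * fact (Suc (Suc m)) ^ 2) * (1 / (16 * F ^ 2)) * F"
      unfolding norm_mult F_def using less[of "Suc m"] less[of m] a[of "Suc m"] 3
      by (intro mult_mono) (auto simp del: orbit_coeff.simps fact_Suc)
    \<comment> \<open>One \<open>F\<close> cancels, and \<open>fact_growth\<close> bounds the
      remaining \<open>1 / (16 * F)\<close> by the inverse square of \<open>m + 3\<close>.\<close>
    also have "\<dots> \<le> 1 / (16 * (real (Suc (Suc (Suc m))) * fact (Suc (Suc m))) ^ 2)"
      using fact_growth[of m] F
      by (simp add: F_def[symmetric] field_simps power2_eq_square del: of_nat_Suc fact_Suc)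
    finally show ?thesis using 3 by simp
  qed (use b in auto)
qed

lemma open_entire_basic:
  assumes "compact K" "open W"
  shows "open {f. apply_entire f ` K \<subseteq> W}"
  unfolding open_entire_def using assms by (intro generate_topology.Basis) auto

lemma not_strongly_transitive: "\<not> strongly_transitive eval_deriv_op"
proof
  assume trans: "strongly_transitive eval_deriv_op"
  \<comment> \<open>\<open>U1\<close> makes f(0) small, \<open>U2\<close> supplies Cauchy's
    estimates on the unit circle, and \<open>V\<close> demands modulus above 1 at 0.\<close>
  define U1 where "U1 = {f. apply_entire f ` {0} \<subseteq> ball 0 (1 / 64)}"
  define U2 where "U2 = {f. apply_entire f ` cball 0 1 \<subseteq> ball 0 1}"
  define V where "V = {f. apply_entire f ` {0} \<subseteq> - cball 0 1}"
  have "Abs_entire (\<lambda>_. 0) \<in> U1" "Abs_entire (\<lambda>_. 0) \<in> U2" "Abs_entire (\<lambda>_. 2) \<in> V"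
    by (auto simp: U1_def U2_def V_def Abs_entire_inverse)
  moreover have "open (U1 \<times> U2)" "open V"
    unfolding U1_def U2_def V_def by (intro open_Times open_entire_basic; force)+
  ultimately obtain n f g where n: "n \<ge> 1" and fg: "f \<in> U1" "g \<in> U2"
      and V: "bilinear_iterate eval_deriv_op n (f, g) \<in> V"
    using trans unfolding strongly_transitive_def by blast
  obtain m where m: "n = Suc m"
    using n by (cases n) auto
  let ?a = "\<lambda>k. (deriv ^^ k) (apply_entire g) 0"
  have a: "norm (?a k) \<le> fact k" for k
  proof -
    have "norm (?a k) \<le> fact k * 1 / 1 ^ k"
    proof (rule Cauchy_inequality)
      show "norm (apply_entire g x) \<le> 1" if "norm (0 - x) = 1" for x
        using fg(2) that unfolding U2_def by (auto simp: image_subset_iff intro: less_imp_le)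
    qed (use apply_entire[of g] in
        \<open>auto intro!: holomorphic_on_imp_continuous_on intro: holomorphic_on_subset\<close>)
    thus ?thesis by simp
  qed
  have "norm (apply_entire (bilinear_iterate eval_deriv_op n (f, g)) 0) =
      norm (orbit_coeff (apply_entire f 0) ?a n) * norm (?a n)"
    by (simp only: bilinear_iterate_def bilinear_orbit_eval_deriv_op norm_mult)
  also have "\<dots> \<le> 1 / (16 * fact n ^ 2) * fact n"
    unfolding m using fg(1) a by (intro mult_mono norm_orbit_coeff_le) (auto simp: U1_def simp del: fact_Suc funpow.simps)
  also have "\<dots> \<le> 1"
    using order_trans[OF _ mult_left_mono[OF fact_ge_1[of n, where 'a = real], of 16], of 1]
    by (simp add: power2_eq_square divide_simps)
  finally show False
    using V by (auto simp: V_def)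
qed

section \<open>A universal coefficient sequence\<close>

definition taylor_ratio :: "(nat \<Rightarrow> complex) \<Rightarrow> nat \<Rightarrow> complex" where
  "taylor_ratio c j = c (Suc (Suc j)) / (c (Suc j) * c j)"

section \<open>Blocks realising a finite list of targets\<close>

fun block :: "(nat \<Rightarrow> complex) \<Rightarrow> complex \<Rightarrow> nat \<Rightarrow> complex" where
  "block p s 0 = 1"
| "block p s (Suc 0) = s"
| "block p s (Suc (Suc k)) = block p s (Suc k) * block p s k * p k"

lemma block_nonzero: "s \<noteq> 0 \<Longrightarrow> (\<And>k. p k \<noteq> 0) \<Longrightarrow> block p s k \<noteq> 0"
  by (induction p s k rule: block.induct) auto

text \<open>As a function of \<open>s\<close>, the term at index \<open>Suc k\<close> is a monomial
  of positive (Fibonacci) degree with nonzero coefficient.\<close>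

lemma filterlim_block:
  assumes "\<And>k. p k \<noteq> 0"
  shows "filterlim (\<lambda>t. norm (block p (of_real t) (Suc k))) at_top at_top"
proof (induction k rule: less_induct)
  case (less k)
  have abs: "filterlim (\<lambda>t :: real. norm (complex_of_real t)) at_top at_top"
    by (simp add: filterlim_abs_real)
  consider "k = 0" | "k = 1" | m where "k = Suc (Suc m)"
    by (metis One_nat_def not0_implies_Suc)
  then show ?case
  proof cases
    case 2
    then show ?thesis
      using filterlim_at_top_mult_tendsto_pos[OF tendsto_const _ abs, of "norm (p 0)"] assms
      by (simp add: norm_mult)
  next
    case 3
    have "filterlim (\<lambda>t. norm (block p (of_real t) (Suc (Suc m))) *
        norm (block p (of_real t) (Suc m))) at_top at_top"
      using 3 by (intro filterlim_at_top_mult_at_top less) auto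
    from filterlim_at_top_mult_tendsto_pos[OF tendsto_const _ this, of "norm (p (Suc m))"]
    show ?thesis
      using assms 3 by (simp add: norm_mult)
  qed (use abs in auto)
qed

lemma block_large:
  assumes "\<And>k. p k \<noteq> 0"
  obtains s where "s \<noteq> 0" "norm (block p s (Suc k)) \<ge> K" "norm (block p s (Suc (Suc k))) \<ge> K"
proof -
  have "\<forall>\<^sub>F t in at_top. norm (block p (of_real t) (Suc k)) \<ge> K \<and>
      norm (block p (of_real t) (Suc (Suc k))) \<ge> K \<and> t > (0 :: real)"
    using filterlim_block[of p, OF assms] unfolding filterlim_at_top
    by (intro eventually_conj eventually_gt_at_top) blast+
  then obtain t :: real where "norm (block p (of_real t) (Suc k)) \<ge> K"
      "norm (block p (of_real t) (Suc (Suc k))) \<ge> K" "t > 0"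
    using eventually_happens'[OF trivial_limit_at_top_linorder] by blast
  thus ?thesis by (intro that[of "of_real t"]) auto
qed

section \<open>Growth at constant ratio between blocks\<close>

fun grow :: "complex \<Rightarrow> (nat \<Rightarrow> complex) \<Rightarrow> nat \<Rightarrow> nat \<Rightarrow> complex" where
  "grow e c N 0 = c 0"
| "grow e c N (Suc 0) = c (Suc 0)"
| "grow e c N (Suc (Suc j)) =
     (if j < N then c (Suc (Suc j)) else e * grow e c N (Suc j) * grow e c N j)"

lemma grow_eq: "j \<le> Suc N \<Longrightarrow> grow e c N j = c j"
  by (induction e c N j rule: grow.induct) auto

lemma grow_nonzero: "e \<noteq> 0 \<Longrightarrow> (\<And>j. c j \<noteq> 0) \<Longrightarrow> grow e c N j \<noteq> 0"
  by (induction e c N j rule: grow.induct) auto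

text \<open>From index \<open>N + 2\<close> on, each term is \<open>e\<close> times the product of
  the two before it, so a factor of modulus at least \<open>2 / e\<close> at least doubles the
  other.\<close>

lemma grow_large:
  assumes "e > 0" "norm (c N) \<ge> 2 / e" "norm (c (Suc N)) \<ge> 2 / e"
  shows "norm (grow (of_real e) c N (N + k)) \<ge> 2 / e \<and>
         norm (grow (of_real e) c N (Suc (N + k))) \<ge> 2 ^ k * (2 / e)"
proof (induction k)
  case 0
  show ?case using assms by (simp add: grow_eq)
next
  case (Suc k)
  have "2 / e \<le> 2 ^ k * (2 / e)"
    using assms(1) by (simp add: field_simps)
  then have "2 / e \<le> norm (grow (of_real e) c N (Suc (N + k)))"
    using Suc by linarith
  moreover have "2 ^ Suc k * (2 / e) \<le> norm (grow (of_real e) c N (Suc (Suc (N + k))))"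
  proof -
    have "2 ^ Suc k * (2 / e) = e * (2 ^ k * (2 / e)) * (2 / e)"
      using assms(1) by (simp add: field_simps)
    also have "\<dots> \<le> e * norm (grow (of_real e) c N (Suc (N + k))) * norm (grow (of_real e) c N (N + k))"
      using Suc assms(1) by (intro mult_mono) auto
    finally show ?thesis using assms(1) by (simp add: norm_mult)
  qed
  ultimately show ?case by simp
qed

text \<open>Layout of \<open>c'\<close>: \<open>c\<close> up to \<open>Suc N\<close>, growth at
  ratio \<open>e\<close> up to \<open>Suc M\<close>, then \<open>C\<close> times a block from
  \<open>n\<close> on, whose entries \<open>d + 1\<close> and \<open>d + 2\<close> sit at
  \<open>N'\<close> and \<open>Suc N'\<close>. If later ratios are at most \<open>e'\<close>, the
  last conclusion bounds their products with \<open>c' n\<close> by \<open>\<eta>\<close>.\<close>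

lemma extend_block:
  fixes c p :: "nat \<Rightarrow> complex"
  assumes c: "\<And>j. c j \<noteq> 0" and p: "\<And>k. p k \<noteq> 0" and "e > 0" "\<eta> > 0"
    and large: "norm (c N) \<ge> 2 / e" "norm (c (Suc N)) \<ge> 2 / e"
  obtains c' N' e' n where "\<And>j. c' j \<noteq> 0" "\<And>j. j \<le> Suc N \<Longrightarrow> c' j = c j" "N < N'"
    "0 < e'" "e' \<le> e" "norm (c' N') \<ge> 2 / e'" "norm (c' (Suc N')) \<ge> 2 / e'"
    "\<And>j. N \<le> j \<Longrightarrow> j < N' \<Longrightarrow> norm (taylor_ratio c' j) \<le> e"
    "N' = Suc (n + d)" "\<And>k. k \<le> d \<Longrightarrow> c' n * taylor_ratio c' (n + k) = p k" "norm (c' n) * e' \<le> \<eta>"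
proof -
  \<comment> \<open>Scaling by \<open>C\<close> turns these bounds into \<open>2 / e'\<close> for
    \<open>e' = \<eta> / C\<close>, whatever \<open>C\<close> is, so \<open>s\<close> can be fixed
    first.\<close>
  obtain s where s: "s \<noteq> 0" "norm (block p s (Suc d)) \<ge> 2 / \<eta>" "norm (block p s (Suc (Suc d))) \<ge> 2 / \<eta>"
    by (rule block_large[of p, OF p])
  define P where "P = Max ((\<lambda>k. norm (p k)) ` {..d})"
  have P: "norm (p k) \<le> P" if "k \<le> d" for k
    using that by (auto simp: P_def)
  have P0: "P > 0"
    using less_le_trans[OF _ P[of 0], of 0] p[of 0] by simp
  \<comment> \<open>The first bound makes the block ratios at most \<open>e\<close>; the second
    gives \<open>e' \<le> e\<close>.\<close>
  define C where "C = max (P / e) (\<eta> / e)"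
  have C: "C > 0" "P / C \<le> e" "\<eta> / C \<le> e"
    using P0 \<open>e > 0\<close> \<open>\<eta> > 0\<close> by (auto simp: C_def field_simps max_def)
  \<comment> \<open>Two ratios straddle the junction, with moduli
    \<open>C / (norm (u (Suc M)) * norm (u M))\<close> and \<open>norm s / norm (u (Suc M))\<close>.
    Modulus \<open>B\<close> at \<open>Suc M\<close>, with \<open>1 / e\<close> at \<open>M\<close>,
    makes both at most \<open>e\<close>.\<close>
  define B where "B = max (norm s / e) C"
  obtain m where m: "(2 :: real) ^ m > max 1 (B * e)"
    using real_arch_pow[of 2 "max 1 (B * e)"] by auto
  define M where "M = Suc (N + m)"
  define n where "n = Suc (Suc M)"
  define u where "u = grow (of_real e) c N"
  define c' where "c' = (\<lambda>j. if j < n then u j else of_real C * block p s (j - n))"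
  have u0: "u j \<noteq> 0" for j
    unfolding u_def by (rule grow_nonzero) (use c \<open>e > 0\<close> in auto)
  have u_large: "norm (u M) \<ge> 1 / e" "norm (u (Suc M)) \<ge> 1 / e"  "norm (u (Suc M)) \<ge> B"
  proof -
    have "B \<le> 2 ^ Suc m * (2 / e)" "1 / e \<le> 2 ^ Suc m * (2 / e)" "1 / e \<le> 2 / e"
      using m \<open>e > 0\<close> by (auto simp: field_simps)
    thus "norm (u M) \<ge> 1 / e" "norm (u (Suc M)) \<ge> 1 / e" "norm (u (Suc M)) \<ge> B"
      using grow_large[OF \<open>e > 0\<close> large, of "Suc m"]
      unfolding u_def M_def by simp_all
  qed
  \<comment> \<open>Scaling a sequence by \<open>C\<close> divides its ratios by \<open>C\<close>;
    the factor \<open>c' n = C\<close> restores the target.\<close>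
  have ratio_block: "taylor_ratio c' (n + k) = p k / of_real C" for k
    using C block_nonzero[of s p, OF s(1) p]
    by (simp add: taylor_ratio_def c'_def Suc_diff_le field_simps)
  have B: "norm s / B \<le> e" "C \<le> B" "B > 0"
    using C(1) s(1) \<open>e > 0\<close> by (auto simp: B_def field_simps max_def)
  show ?thesis
  proof (rule that[of c' "n + Suc d" "\<eta> / C" n])
    show "c' j \<noteq> 0" for j
      using u0 C(1) block_nonzero[of s p, OF s(1) p] by (simp add: c'_def)
    show "c' j = c j" if "j \<le> Suc N" for j
      using that by (simp add: c'_def u_def grow_eq n_def M_def)
    show "norm (c' (n + Suc d)) \<ge> 2 / (\<eta> / C)" "norm (c' (Suc (n + Suc d))) \<ge> 2 / (\<eta> / C)"
      using mult_left_mono[OF s(2), of C] mult_left_mono[OF s(3), of C] C(1)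
      by (auto simp: c'_def norm_mult mult.commute)
    show "norm (taylor_ratio c' j) \<le> e" if j: "N \<le> j" "j < n + Suc d" for j
    proof -
      consider "j < M" | "j = M" | "j = Suc M" | "n \<le> j"
        unfolding n_def by linarith
      then show ?thesis
      proof cases
        case 1
        then show ?thesis
          using u0[of j] u0[of "Suc j"] j(1) \<open>e > 0\<close>
          by (simp add: taylor_ratio_def c'_def n_def) (simp add: u_def)
      next
        case 2
        have "norm (taylor_ratio c' j) = C / (norm (u (Suc M)) * norm (u M))"
          using C(1) by (simp add: taylor_ratio_def c'_def n_def 2 norm_mult norm_divide)
        also have "\<dots> \<le> C / (B * (1 / e))"
          using u_large C(1) B \<open>e > 0\<close> by (intro divide_left_mono mult_mono) (auto simp: u0)
        also have "\<dots> \<le> e"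
          using B C(1) \<open>e > 0\<close> by (simp add: field_simps)
        finally show ?thesis .
      next
        case 3
        have "norm (taylor_ratio c' j) = norm s / norm (u (Suc M))"
          using C(1) by (simp add: taylor_ratio_def c'_def n_def 3 norm_mult norm_divide)
        also have "\<dots> \<le> norm s / B"
          using u_large B by (intro divide_left_mono) (auto simp: u0)
        finally show ?thesis using B by simp
      next
        case 4
        define k where "k = j - n"
        have k: "j = n + k" "k \<le> d" using 4 j(2) by (auto simp: k_def)
        have "norm (p k) / C \<le> P / C"
          using P[OF k(2)] C(1) by (intro divide_right_mono) auto
        then show ?thesis
          using C by (simp add: k(1) ratio_block norm_divide)
      qed
    qed
    show "c' n * taylor_ratio c' (n + k) = p k" if "k \<le> d" for k
      using C(1) by (simp add: ratio_block) (simp add: c'_def)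
    show "norm (c' n) * (\<eta> / C) \<le> \<eta>"
      using C(1) by (simp add: c'_def)
  qed (use C \<open>\<eta> > 0\<close> in \<open>auto simp: n_def M_def\<close>)
qed

section \<open>Dense targets and the limit sequence\<close>

lemma dense_nonzero_sequence:
  obtains v :: "nat \<Rightarrow> complex" where "\<And>i. v i \<noteq> 0" "\<And>z e. e > 0 \<Longrightarrow> \<exists>i. norm (v i - z) \<le> e"
proof -
  obtain D :: "complex set" where D: "countable D" "\<And>X. open X \<Longrightarrow> X \<noteq> {} \<Longrightarrow> \<exists>d\<in>D. d \<in> X"
    by (rule countable_dense_setE) blast
  have dense: "\<exists>d\<in>D - {0}. norm (d - z) \<le> e" if "e > 0" for z e
  proof -
    \<comment> \<open>Singletons are not open, so deleting 0 preserves density. Targets must be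
      nonzero to keep the scalars nonzero.\<close>
    have "ball z e - {0} \<noteq> {}"
      using that by (metis Diff_eq_empty_iff open_ball centre_in_ball not_open_singleton subset_singletonD empty_iff)
    then obtain d where "d \<in> D" "d \<in> ball z e - {0}"
      using D(2)[of "ball z e - {0}"] by (auto simp: open_delete)
    thus ?thesis by (intro bexI[of _ d]) (auto simp: dist_norm norm_minus_commute)
  qed
  have ne: "D - {0} \<noteq> {}" using dense[of 1 0] by auto
  have "countable (D - {0})" using D(1) by simp
  note range = range_from_nat_into[OF ne this]
  show ?thesis
  proof (rule that[of "from_nat_into (D - {0})"])
    show "from_nat_into (D - {0}) i \<noteq> 0" for i
      using from_nat_into[OF ne, of i] by simp
    show "\<exists>i. norm (from_nat_into (D - {0}) i - z) \<le> e" if "e > 0" for z e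
      using dense[OF that, of z] range by (metis rangeE)
  qed
qed

text \<open>Stage \<open>i\<close> appends a block for the i-th target and leaves a growing initial
  segment untouched, so the stages have a limit. Decreasing bounds on the later ratios make the
  products past each block small.\<close>

lemma universal_sequence:
  obtains c :: "nat \<Rightarrow> complex" where "c 0 = 1" "c (Suc 0) = 1" "\<And>j. c j \<noteq> 0"
    "\<And>j. norm (taylor_ratio c j) \<le> 2"
    "\<And>t d e. e > 0 \<Longrightarrow> \<exists>n. \<forall>k. norm (c n * taylor_ratio c (n + k) - (if k \<le> d then t k else 0)) \<le> e"
proof -
  obtain v :: "nat \<Rightarrow> complex" where v: "\<And>i. v i \<noteq> 0" "\<And>z e. e > 0 \<Longrightarrow> \<exists>i. norm (v i - z) \<le> e"
    by (rule dense_nonzero_sequence) blast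
  \<comment> \<open>Enumerates all triples of a degree, a list of indices into \<open>v\<close> and a precision. An index
    outside the list gives an unspecified coefficient, but still a nonzero one.\<close>
  define tgt :: "nat \<Rightarrow> nat \<times> nat list \<times> nat" where "tgt = from_nat"
  define dg where "dg i = fst (tgt i)" for i :: nat
  define p where "p i k = v (fst (snd (tgt i)) ! k)" for i k :: nat
  define \<eta> where "\<eta> i = 1 / real (Suc (snd (snd (tgt i))))" for i :: nat
  \<comment> \<open>In a state \<open>(c, N, e)\<close>, \<open>c\<close> is settled up to
    \<open>Suc N\<close>, and ratios from \<open>N\<close> on are to stay at most
    \<open>e\<close>.\<close>
  define good where "good = (\<lambda>(c :: nat \<Rightarrow> complex, N, e). (\<forall>j. c j \<noteq> 0) \<and> e > 0 \<and> norm (c N) \<ge> 2 / e \<and>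
      norm (c (Suc N)) \<ge> 2 / e)"
  define step where "step = (\<lambda>(i :: nat) (c :: nat \<Rightarrow> complex, N, e) (c', N', e').
      (\<forall>j\<le>Suc N. c' j = c j) \<and> N < N' \<and> e' \<le> e \<and>
      (\<forall>j. N \<le> j \<and> j < N' \<longrightarrow> norm (taylor_ratio c' j) \<le> e) \<and>
      (\<exists>n. N' = Suc (n + dg i) \<and> (\<forall>k\<le>dg i. c' n * taylor_ratio c' (n + k) = p i k) \<and>
         norm (c' n) * e' \<le> \<eta> i))"
  have "\<exists>f. \<forall>i. (good (f i) \<and> (i = 0 \<longrightarrow> f i = (\<lambda>_. 1, 0, 2))) \<and> step i (f i) (f (Suc i))"
  proof (rule dependent_nat_choice)
    \<comment> \<open>The constant sequence 1 meets the threshold \<open>2 / e\<close> with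
      \<open>e = 2\<close>, the source of the final bound on ratios.\<close>
    show "\<exists>x. good x \<and> (0 = 0 \<longrightarrow> x = (\<lambda>_. 1, 0, 2))"
      by (simp add: good_def)
    fix x and i :: nat assume "good x \<and> (i = 0 \<longrightarrow> x = (\<lambda>_. 1, 0, 2))"
    then obtain c N e where x: "x = (c, N, e)" and *: "\<And>j. c j \<noteq> 0" "e > 0" "norm (c N) \<ge> 2 / e"
      "norm (c (Suc N)) \<ge> 2 / e" by (cases x) (auto simp: good_def)
    have "p i k \<noteq> 0" for k using v(1) by (simp add: p_def)
    moreover have "\<eta> i > 0" by (simp add: \<eta>_def)
    ultimately obtain c' N' e' n where "\<And>j. c' j \<noteq> 0" "\<And>j. j \<le> Suc N \<Longrightarrow> c' j = c j" "N < N'"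
      "0 < e'" "e' \<le> e" "norm (c' N') \<ge> 2 / e'" "norm (c' (Suc N')) \<ge> 2 / e'"
      "\<And>j. N \<le> j \<Longrightarrow> j < N' \<Longrightarrow> norm (taylor_ratio c' j) \<le> e"
      "N' = Suc (n + dg i)" "\<And>k. k \<le> dg i \<Longrightarrow> c' n * taylor_ratio c' (n + k) = p i k" "norm (c' n) * e' \<le> \<eta> i"
      using extend_block[where p = "p i" and \<eta> = "\<eta> i" and d = "dg i", OF *(1) _ *(2) _ *(3,4)] by blast
    then show "\<exists>y. (good y \<and> (Suc i = 0 \<longrightarrow> y = (\<lambda>_. 1, 0, 2))) \<and> step i x y"
      by (intro exI[of _ "(c', N', e')"]) (auto simp: good_def step_def x)
  qed
  then obtain f where f: "\<And>i. good (f i)" "f 0 = (\<lambda>_. 1, 0, 2)" "\<And>i. step i (f i) (f (Suc i))"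
    by auto
  define C where "C i = fst (f i)" for i
  define N where "N i = fst (snd (f i))" for i
  define E where "E i = snd (snd (f i))" for i
  have f_eq: "f i = (C i, N i, E i)" for i by (simp add: C_def N_def E_def)
  have init: "C 0 = (\<lambda>_. 1)" "N 0 = 0" "E 0 = 2"
    using f(2) f_eq[of 0] by auto
  have nz: "C i j \<noteq> 0" and E: "E i > 0" for i j
    using f(1)[of i] by (auto simp: good_def f_eq)
  have agree: "C (Suc i) j = C i j" if "j \<le> Suc (N i)" for i j
    using f(3)[of i] that by (auto simp: step_def f_eq)
  have N_less: "N i < N (Suc i)" for i
    using f(3)[of i] by (auto simp: step_def f_eq)
  have E_le: "E (Suc i) \<le> E i" for i
    using f(3)[of i] by (auto simp: step_def f_eq)
  have small: "norm (taylor_ratio (C (Suc i)) j) \<le> E i" if "N i \<le> j" "j < N (Suc i)" for i j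
    using f(3)[of i] that by (auto simp: step_def f_eq)
  have hit: "\<exists>n. N (Suc i) = Suc (n + dg i) \<and>
      (\<forall>k\<le>dg i. C (Suc i) n * taylor_ratio (C (Suc i)) (n + k) = p i k) \<and>
      norm (C (Suc i) n) * E (Suc i) \<le> \<eta> i" for i
    using f(3)[of i] by (auto simp: step_def f_eq)
  have N_mono: "strict_mono N" using N_less by (rule strict_mono_Suc_iff[THEN iffD2, rule_format])
  have N_ge: "i \<le> N i" for i using strict_mono_imp_increasing[OF N_mono] .
  have E_anti: "antimono E" using E_le by (intro decseq_SucI) auto
  \<comment> \<open>Diagonal limit: by \<open>N_ge\<close>, stage \<open>j\<close> has already
    settled index \<open>j\<close>.\<close>
  define c where "c j = C j j" for j
  have stable: "C (i + m) j = C i j" if "j \<le> Suc (N i)" for i m j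
  proof (induction m)
    case (Suc m)
    have "N i \<le> N (i + m)" using N_mono by (simp add: strict_mono_less_eq)
    with Suc that show ?case using agree[of j "i + m"] by simp
  qed simp
  have c_eq: "c j = C i j" if "j \<le> Suc (N i)" for i j
  proof (cases "i \<le> j")
    case True
    then show ?thesis using stable[OF that, of "j - i"] by (simp add: c_def)
  next
    case False
    then show ?thesis using stable[of j j "i - j"] N_ge[of j] by (simp add: c_def)
  qed
  have ratio_eq: "taylor_ratio c j = taylor_ratio (C i) j" if "j < N i" for i j
    using that by (simp add: taylor_ratio_def c_eq[of _ i])
  have ratio_le: "norm (taylor_ratio c j) \<le> E i" if "N i \<le> j" for i j
  proof -
    \<comment> \<open>The ratio at \<open>j\<close> is fixed by the extension ending at the first
      \<open>N m\<close> beyond \<open>j\<close>.\<close>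
    define m where "m = (LEAST m. j < N m)"
    have "j < N (Suc j)" using N_ge[of "Suc j"] by simp
    then have m: "j < N m" unfolding m_def by (rule LeastI)
    then have "m > i" using that N_mono by (meson le_less_trans strict_mono_less)
    then obtain l where l: "m = Suc l" by (cases m) auto
    have "N l \<le> j" using not_less_Least[of l "\<lambda>m. j < N m"] l unfolding m_def by auto
    with m have "norm (taylor_ratio c j) \<le> E l"
      using small[of l j] by (simp add: l ratio_eq)
    also have "\<dots> \<le> E i" using E_anti \<open>m > i\<close> l by (auto simp: antimono_def)
    finally show ?thesis .
  qed
  show ?thesis
  proof (rule that)
    show "c 0 = 1" "c (Suc 0) = 1" using c_eq[of _ 0] by (simp_all add: init)
    show "c j \<noteq> 0" for j using nz by (simp add: c_def)
    show "norm (taylor_ratio c j) \<le> 2" for j using ratio_le[of 0 j] by (simp add: init)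
    fix t :: "nat \<Rightarrow> complex" and d :: nat and e :: real
    assume "e > 0"
    then obtain m where m: "1 / real (Suc m) < e" using nat_approx_posE by blast
    have "\<forall>k. \<exists>i. norm (v i - t k) \<le> e" using v(2)[OF \<open>e > 0\<close>] by blast
    then obtain w where w: "\<And>k. norm (v (w k) - t k) \<le> e" by metis
    \<comment> \<open>The list has \<open>Suc d\<close> entries, so every \<open>k \<le> d\<close>
      is a valid index.\<close>
    define i where "i = to_nat (d, map w [0..<Suc d], m)"
    have i: "dg i = d" "\<eta> i \<le> e" "\<And>k. k \<le> d \<Longrightarrow> p i k = v (w k)"
      using m by (auto simp: dg_def \<eta>_def p_def tgt_def i_def simp del: upt_Suc)
    obtain n where n: "N (Suc i) = Suc (n + dg i)"
        "\<And>k. k \<le> dg i \<Longrightarrow> C (Suc i) n * taylor_ratio (C (Suc i)) (n + k) = p i k"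
        "norm (C (Suc i) n) * E (Suc i) \<le> \<eta> i"
      using hit by blast
    have cn: "c n = C (Suc i) n" using n(1) by (intro c_eq) simp
    have "norm (c n * taylor_ratio c (n + k) - (if k \<le> d then t k else 0)) \<le> e" for k
    proof (cases "k \<le> d")
      case True
      then show ?thesis
        using n(1,2) w[of k] by (simp add: cn ratio_eq[of _ "Suc i"] i)
    next
      case False
      \<comment> \<open>Here \<open>n + k \<ge> N (Suc i)\<close>, so the bound
        \<open>E (Suc i)\<close> applies, which was chosen relative to
        \<open>norm (c n)\<close>.\<close>
      have "norm (taylor_ratio c (n + k)) \<le> E (Suc i)"
        using False n(1) i(1) by (intro ratio_le) simp
      then have "norm (c n) * norm (taylor_ratio c (n + k)) \<le> norm (c n) * E (Suc i)"
        by (rule mult_left_mono) simp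
      with n(3) i(2) False show ?thesis by (simp add: cn norm_mult)
    qed
    then show "\<exists>n. \<forall>k. norm (c n * taylor_ratio c (n + k) - (if k \<le> d then t k else 0)) \<le> e"
      by blast
  qed
qed

section \<open>Hypercyclicity\<close>

text \<open>Padding \<open>t\<close> with zeros turns the polynomial into an exponential generating
  function; the difference has coefficients bounded by \<open>e\<close>.\<close>

lemma norm_egf_diff_partial_sum_le:
  assumes a: "\<And>k. norm (a k) \<le> B"
    and close: "\<And>k. norm (a k - (if k \<le> d then t k else 0)) \<le> e"
  shows "norm (egf a z - (\<Sum>k\<le>d. t k / fact k * z ^ k)) \<le> e * exp (norm z)"
proof -
  let ?t = "\<lambda>k. if k \<le> d then t k else 0"
  have finite_sum: "(\<lambda>k. ?t k / fact k * z ^ k) sums (\<Sum>k\<le>d. ?t k / fact k * z ^ k)"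
    by (rule sums_finite) auto
  have "egf a z - (\<Sum>k\<le>d. t k / fact k * z ^ k) = egf a z - (\<Sum>k. ?t k / fact k * z ^ k)"
    using sums_unique[OF finite_sum] by simp
  also have "\<dots> = (\<Sum>k. a k / fact k * z ^ k - ?t k / fact k * z ^ k)"
    unfolding egf_def using summable_norm_cancel[OF summable_egf[of a, OF a]] sums_summable[OF finite_sum]
    by (rule suminf_diff)
  also have "\<dots> = egf (\<lambda>k. a k - ?t k) z"
    unfolding egf_def by (simp add: diff_divide_distrib left_diff_distrib)
  finally show ?thesis
    using norm_egf_le[of "\<lambda>k. a k - ?t k", OF close] by simp
qed

lemma egf_cmult:
  assumes "\<And>k. norm (a k) \<le> B"
  shows "C * egf a z = egf (\<lambda>k. C * a k) z"
  unfolding egf_def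
  using suminf_mult[OF summable_norm_cancel[OF summable_egf[of a, OF assms]], of C] by (simp add: mult_ac)

text \<open>\<open>taylor_ratio\<close> solves the recursion of \<open>orbit_coeff\<close> for the
  Taylor data, so the prescribed sequence really occurs as the scalars of an orbit.\<close>

lemma orbit_coeff_taylor_ratio:
  assumes "c 0 = 1" "\<And>j. c j \<noteq> 0"
  shows "orbit_coeff (c 1) (taylor_ratio c) n = c n"
proof (induction n rule: less_induct)
  case (less n)
  consider "n = 0" | "n = 1" | m where "n = Suc (Suc m)"
    by (metis One_nat_def not0_implies_Suc)
  then show ?case
    using assms less by cases (auto simp: taylor_ratio_def)
qed

lemma hypercyclic_eval_deriv_op: "hypercyclic eval_deriv_op"
proof -
  obtain c :: "nat \<Rightarrow> complex" where c: "c 0 = 1" "c 1 = 1" "\<And>j. c j \<noteq> 0"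
    and le2: "\<And>j. norm (taylor_ratio c j) \<le> 2"
    and univ: "\<And>t d e. e > 0 \<Longrightarrow>
      \<exists>n. \<forall>k. norm (c n * taylor_ratio c (n + k) - (if k \<le> d then t k else 0)) \<le> e"
    by (rule universal_sequence) auto
  define a where "a = taylor_ratio c"
  have a: "norm (a k) \<le> 2" for k using le2 by (simp add: a_def)
  \<comment> \<open>The value f(0) = 1 matches \<open>c 1\<close>.\<close>
  define f where "f = Abs_entire (\<lambda>_. 1)"
  define g where "g = Abs_entire (egf a)"
  have f: "apply_entire f = (\<lambda>_. 1)" and g: "apply_entire g = egf a"
    using egf_holomorphic[of a, OF a] by (simp_all add: f_def g_def Abs_entire_inverse)
  let ?x = "bilinear_orbit eval_deriv_op (f, g)"
  have orbit: "apply_entire (?x (Suc n)) z = egf (\<lambda>k. c n * a (n + k)) z" for n z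
  proof -
    have "orbit_coeff 1 a n = c n"
      using orbit_coeff_taylor_ratio[of c n] c by (simp add: a_def)
    then show ?thesis
      using a by (simp add: bilinear_orbit_eval_deriv_op f g higher_deriv_egf[of a, OF a] egf_cmult[of _ 2])
  qed
  have "S \<inter> range ?x \<noteq> {}" if S: "open S" "h \<in> S" for S h
  proof -
    obtain R e where e: "e > 0"
      and S: "\<And>f. \<forall>z. norm z \<le> R \<longrightarrow> norm (apply_entire f z - apply_entire h z) < e \<Longrightarrow> f \<in> S"
      using open_entire_contains_nbhd[OF S] by blast
    let ?t = "\<lambda>k. (deriv ^^ k) (apply_entire h) 0"
    obtain d where d: "\<And>z. norm z \<le> R \<Longrightarrow>
        norm (apply_entire h z - (\<Sum>k\<le>d. ?t k / fact k * z ^ k)) < e / 2"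
      using taylor_uniform[of "apply_entire h" "e / 2"] apply_entire[of h] e by auto
    \<comment> \<open>Dividing by \<open>exp R\<close> offsets the factor
      \<open>exp (norm z)\<close> on the disc; the other \<open>e / 2\<close> is the Taylor
      remainder.\<close>
    obtain n where n: "\<And>k. norm (c n * a (n + k) - (if k \<le> d then ?t k else 0)) \<le> e / 2 / exp R"
      using univ[of "e / 2 / exp R" d ?t] e unfolding a_def by auto
    have "norm (apply_entire (?x (Suc n)) z - apply_entire h z) < e" if z: "norm z \<le> R" for z
    proof -
      let ?P = "\<Sum>k\<le>d. ?t k / fact k * z ^ k"
      have "norm (c n * a (n + k)) \<le> norm (c n) * 2" for k
        using a by (simp add: norm_mult mult_left_mono)
      then have "norm (apply_entire (?x (Suc n)) z - ?P) \<le> e / 2 / exp R * exp (norm z)"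
        unfolding orbit by (rule norm_egf_diff_partial_sum_le[OF _ n])
      also have "\<dots> \<le> e / 2 / exp R * exp R"
        using z e by (intro mult_left_mono) auto
      finally have "norm (apply_entire (?x (Suc n)) z - ?P) \<le> e / 2" by simp
      with d[OF z] show ?thesis
        using norm_triangle_ineq4[of "apply_entire (?x (Suc n)) z - ?P" "apply_entire h z - ?P"] by simp
    qed
    then show ?thesis using S[of "?x (Suc n)"] by blast
  qed
  then have "closure (range ?x) = UNIV"
    by (fastforce simp: closure_iff_nhds_not_empty)
  then show ?thesis
    unfolding hypercyclic_def hypercyclic_vector_def by blast
qed

theorem theorem2p4:
  "hypercyclic eval_deriv_op \<and> \<not> strongly_transitive eval_deriv_op"
  using hypercyclic_eval_deriv_op not_strongly_transitive by blast

end
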